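(* There exist universal constants $c,C>0$, and for every $\beta>1$ constants $c_\beta,C_\beta>0$ depending only on $\beta$, such that the following holds for every $\lambda>0$. Let $X=Y-\lambda$ with $Y\sim\mathrm{Poisson}(\lambda)$. Then (right tail) if $x\ge0$ and $x+\lambda\ge1$, then $$\mathbb{P}(X\ge x)\ge c\exp\left(-C\cdot\frac{x^2}{2\lambda}\psi_{Benn}(x/\lambda)\right);$$ if $0<x+\lambda<1$, then $\mathbb{P}(X\ge x)=1-e^{-\lambda}$; (left tail) for all $\beta>1$, if $0\le x\le\frac\lambda\beta$, then $$\mathbb{P}(X\le-x)\ge c_\beta\exp\left(-C_\beta\cdot\frac{x^2}{2\lambda}\psi_{Benn}(x/\lambda)\right).$$
   Context: The Bennett function $\psi_{Benn}$ is defined for $t>-1$ by $\psi_{Benn}(t)=\frac{(1+t)\log(1+t)-t}{t^2/2}$ if $t\ne0$, and $\psi_{Benn}(0)=1$. *)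

theory Defs
  imports "HOL-Probability.Probability"
begin

text \<open>Only the values at \<open>t > -1\<close> are meaningful; outside that range \<open>ln\<close> takes library default
  values.\<close>

definition psi_Benn :: "real \<Rightarrow> real" where
  "psi_Benn t = (if t = 0 then 1 else ((1 + t) * ln (1 + t) - t) / (t\<^sup>2 / 2))"

end

theory Submission imports Defs begin

text \<open>
  Write \<open>y = \<lambda> + x\<close>. The exponent \<open>x\<^sup>2 / (2 \<lambda>) \<cdot> psi_Benn (x / \<lambda>)\<close> is the relative entropy
  \<open>D(y, \<lambda>) = y ln (y / \<lambda>) - y + \<lambda>\<close> of the Poisson law with mean \<open>y\<close> with respect to the one with
  mean \<open>\<lambda>\<close>. Both lower bounds therefore come from a change of measure (\<open>poisson_tilting\<close>), as in
  Cramer's theorem: replace the rate \<open>\<lambda>\<close> by a rate \<open>\<mu>\<close> under which the tail event is likely, and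
  bound the likelihood ratio on it. Stirling's formula and local estimates of point masses are
  avoided, since under the rate \<open>\<mu>\<close> Chebyshev's inequality already gives the window
  \<open>[\<mu> - 2 \<surd>\<mu>, \<mu> + 2 \<surd>\<mu>]\<close> mass at least \<open>3/4\<close> (\<open>poisson_concentration\<close>). The rate \<open>\<mu>\<close> is
  chosen so that the window starts exactly at the threshold (right tail) or ends exactly at it
  (left tail); no rounding to integers is involved.

  What remains is to compare the logarithm of the likelihood ratio with \<open>D(y, \<lambda>)\<close>. For the right
  tail the excess is at most of order \<open>\<surd>y ln (y / \<lambda>) + 1\<close>. With \<open>u = ln (y / \<lambda>)\<close> one has
  \<open>D(y, \<lambda>) = y (u - 1 + exp (-u))\<close>, which is of order \<open>y u\<^sup>2\<close> for small \<open>u\<close> and \<open>y u\<close> for large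
  \<open>u\<close>; since \<open>y \<ge> 1\<close>, it dominates \<open>\<surd>y u\<close> up to a constant. For the left tail everything happens
  at the Gaussian scale: the exponent is at least \<open>x\<^sup>2 / (8 \<lambda>)\<close>, and the log-likelihood ratio is at
  most of order \<open>x\<^sup>2 / \<lambda> + 1\<close> as long as the threshold \<open>\<lambda> - x\<close> keeps a fixed proportion of
  \<open>\<lambda>\<close> and \<open>\<lambda> \<ge> 1\<close>; for \<open>\<lambda> < 1\<close> the atom at \<open>0\<close> suffices.
\<close>

section \<open>Concentration of the Poisson distribution\<close>

text \<open>The Stein--Chen identity \<open>E (Y f(Y)) = \<mu> E (f(Y + 1))\<close> in terms of series. Taking for \<open>f\<close>
  first a constant and then the identity gives the first two moments.\<close>

lemma poisson_stein_chen:
  fixes f :: "nat \<Rightarrow> real"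
  assumes "m > 0" and "(\<lambda>k. f (Suc k) * pmf (poisson_pmf m) k) sums S"
  shows "(\<lambda>k. real k * f k * pmf (poisson_pmf m) k) sums (m * S)"
proof -
  have "m * (f (Suc k) * pmf (poisson_pmf m) k)
      = real (Suc k) * f (Suc k) * pmf (poisson_pmf m) (Suc k)" for k
    using assms(1) by (simp add: divide_simps)
  with sums_mult[OF assms(2), of m]
  have "(\<lambda>k. real (Suc k) * f (Suc k) * pmf (poisson_pmf m) (Suc k)) sums (m * S)"
    by simp
  then show ?thesis
    by (subst (asm) sums_Suc_iff) simp
qed

lemma poisson_variance:
  assumes "m > 0"
  shows "(\<lambda>k. (real k - m)\<^sup>2 * pmf (poisson_pmf m) k) sums m"
proof -
  let ?p = "pmf (poisson_pmf m)"
  have mass: "?p sums 1"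
    using sums_infsetsum_nat'[of ?p] infsetsum_pmf_eq_1[of "poisson_pmf m" UNIV] by auto
  have mean: "(\<lambda>k. real k * ?p k) sums m"
    using poisson_stein_chen[OF assms, of "\<lambda>_. 1" 1] mass by simp
  have "(\<lambda>k. real (Suc k) * ?p k) sums (m + 1)"
    using sums_add[OF mean mass] by (simp add: algebra_simps)
  then have second: "(\<lambda>k. real k * real k * ?p k) sums (m * (m + 1))"
    using poisson_stein_chen[OF assms, of "\<lambda>k. real k"] by simp
  have "(\<lambda>k. real k * real k * ?p k - 2 * m * (real k * ?p k) + m\<^sup>2 * ?p k)
      sums (m * (m + 1) - 2 * m * m + m\<^sup>2 * 1)"
    by (intro sums_add sums_diff sums_mult second mean mass)
  then show ?thesis
    by (simp add: algebra_simps power2_eq_square)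
qed

text \<open>This is Chebyshev's inequality. Parametrizing the rate by its standard deviation \<open>s\<close> makes
  the ends of the window quadratic in \<open>s\<close>, so that a window with a prescribed end is found by solving
  a quadratic equation.\<close>

lemma poisson_concentration:
  assumes "s > 0"
  shows "measure (measure_pmf (poisson_pmf (s\<^sup>2))) {k. \<bar>real k - s\<^sup>2\<bar> \<le> 2 * s} \<ge> 3 / 4"
proof -
  let ?M = "measure_pmf (poisson_pmf (s\<^sup>2))" and ?p = "pmf (poisson_pmf (s\<^sup>2))"
  let ?B = "{k. \<bar>real k - s\<^sup>2\<bar> \<le> 2 * s}"
  have "s\<^sup>2 > 0" using assms by simp
  note var = sums_divide[OF poisson_variance[OF this], of "4 * s\<^sup>2"]
  have tail: "(\<lambda>k. if k \<in> - ?B then ?p k else 0) sums measure ?M (- ?B)"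
    unfolding measure_pmf_conv_infsetsum by (rule sums_infsetsum_nat) auto
  have "measure ?M (- ?B) \<le> s\<^sup>2 / (4 * s\<^sup>2)"
  proof (rule sums_le[OF _ tail var])
    fix k
    show "(if k \<in> - ?B then ?p k else 0) \<le> (real k - s\<^sup>2)\<^sup>2 * ?p k / (4 * s\<^sup>2)"
    proof (cases "k \<in> ?B")
      case False
      then have "(2 * s)\<^sup>2 \<le> \<bar>real k - s\<^sup>2\<bar>\<^sup>2"
        using assms by (intro power_mono) auto
      then have "1 \<le> (real k - s\<^sup>2)\<^sup>2 / (4 * s\<^sup>2)"
        using assms by (simp add: divide_simps power_mult_distrib)
      then have "1 * ?p k \<le> (real k - s\<^sup>2)\<^sup>2 / (4 * s\<^sup>2) * ?p k"
        by (rule mult_right_mono) (rule pmf_nonneg)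
      with False show ?thesis by simp
    qed (use assms in \<open>simp add: pmf_nonneg\<close>)
  qed
  then show ?thesis
    using assms measure_pmf.prob_compl[of ?B "poisson_pmf (s\<^sup>2)"]
    by (simp add: Compl_eq_Diff_UNIV)
qed

section \<open>Change of measure\<close>

text \<open>The expression bounded by \<open>F\<close> is the logarithm of the likelihood ratio of the rates \<open>m\<close> and
  \<open>l\<close> at \<open>k\<close>.\<close>

lemma poisson_tilting:
  assumes "m > 0" "l > 0" and A: "\<And>k. k \<in> A \<Longrightarrow> real k * ln (m / l) - m + l \<le> F"
    and "A \<subseteq> B"
  shows "measure (measure_pmf (poisson_pmf m)) A * exp (- F)
         \<le> measure (measure_pmf (poisson_pmf l)) B"
proof -
  let ?p = "pmf (poisson_pmf m)" and ?q = "pmf (poisson_pmf l)"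
  have ratio: "?p k * exp (- (real k * ln (m / l) - m + l)) = ?q k" for k
  proof -
    have "exp (- (real k * ln (m / l) - m + l)) = exp m / exp l * inverse ((m / l) ^ k)"
      using assms(1,2)
      by (simp add: exp_diff exp_add exp_minus exp_of_nat_mult field_simps)
    then show ?thesis
      using assms(1,2) by (simp add: exp_minus field_simps)
  qed
  have "measure (measure_pmf (poisson_pmf m)) A * exp (- F) = (\<Sum>\<^sub>ak\<in>A. ?p k * exp (- F))"
    unfolding measure_pmf_conv_infsetsum by (rule infsetsum_cmult_left[symmetric]) auto
  also have "\<dots> \<le> (\<Sum>\<^sub>ak\<in>A. ?q k)"
  proof (rule infsetsum_mono)
    fix k assume "k \<in> A"
    then have "?p k * exp (- F) \<le> ?p k * exp (- (real k * ln (m / l) - m + l))"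
      using A[of k] by (intro mult_left_mono) (simp_all add: pmf_nonneg del: pmf_poisson)
    then show "?p k * exp (- F) \<le> ?q k"
      unfolding ratio .
  qed (auto intro!: abs_summable_on_cmult_left)
  also have "\<dots> = measure (measure_pmf (poisson_pmf l)) A"
    by (simp only: measure_pmf_conv_infsetsum)
  also have "\<dots> \<le> measure (measure_pmf (poisson_pmf l)) B"
    using \<open>A \<subseteq> B\<close> by (intro measure_pmf.finite_measure_mono) auto
  finally show ?thesis .
qed

section \<open>The exponent as a relative entropy\<close>

text \<open>The Kullback--Leibler divergence of the Poisson law with mean \<open>y\<close> from the one with mean
  \<open>l\<close>.\<close>

definition poisson_entropy :: "real \<Rightarrow> real \<Rightarrow> real" where
  "poisson_entropy y l = y * ln (y / l) - y + l"

lemma Benn_exponent_eq_entropy: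
  assumes "l > 0"
  shows "x\<^sup>2 / (2 * l) * psi_Benn (x / l) = poisson_entropy (l + x) l"
proof (cases "x = 0")
  case False
  then have "psi_Benn (x / l) = ((1 + x / l) * ln (1 + x / l) - x / l) / ((x / l)\<^sup>2 / 2)"
    using assms by (simp add: psi_Benn_def)
  moreover have "x\<^sup>2 / (2 * l) * (h / ((x / l)\<^sup>2 / 2)) = l * h" for h
    using False assms by (simp add: field_simps power2_eq_square)
  ultimately have "x\<^sup>2 / (2 * l) * psi_Benn (x / l) = l * ((1 + x / l) * ln (1 + x / l) - x / l)"
    by (simp only:)
  also have "1 + x / l = (l + x) / l"
    using assms by (simp add: field_simps)
  also have "l * ((l + x) / l * L - x / l) = (l + x) * L - (l + x) + l" for L
    using assms by (simp add: field_simps)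
  finally show ?thesis
    by (simp only: poisson_entropy_def)
qed (use assms in \<open>simp add: poisson_entropy_def\<close>)

lemma poisson_entropy_exp_form:
  assumes "y > 0" "l > 0"
  shows "poisson_entropy y l = y * (ln (y / l) - 1 + exp (- ln (y / l)))"
  using assms by (simp add: poisson_entropy_def exp_minus field_simps)

text \<open>This is \<open>exp (-u) \<ge> (1 - u / 2)\<^sup>2\<close>, the square of the tangent bound for \<open>exp (-u / 2)\<close>.\<close>

lemma exp_remainder_ge_square:
  fixes u :: real
  assumes "0 \<le> u" "u \<le> 2"
  shows "u\<^sup>2 / 4 \<le> u - 1 + exp (- u)"
proof -
  have "1 - u / 2 \<le> exp (- (u / 2))"
    using exp_ge_add_one_self[of "- (u / 2)"] by simp
  then have "(1 - u / 2)\<^sup>2 \<le> (exp (- (u / 2)))\<^sup>2"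
    using assms by (intro power_mono) auto
  also have "\<dots> = exp (- u)"
    by (simp add: exp_double[symmetric])
  finally show ?thesis
    by (simp add: power2_eq_square algebra_simps)
qed

text \<open>The term \<open>\<surd>y ln (y / l)\<close> is what a shift of the threshold \<open>y\<close> by \<open>\<surd>y\<close> costs in the right
  tail. For a moderate ratio \<open>y / l\<close> it is absorbed by completing a square, for a large ratio because
  both sides are then linear in the logarithm.\<close>

lemma sqrt_log_le_entropy:
  assumes "l > 0" "l \<le> y" "1 \<le> y"
  shows "sqrt y * ln (y / l) \<le> 1 + 2 * poisson_entropy y l"
proof -
  define u where "u = ln (y / l)"
  have u0: "u \<ge> 0" using assms by (simp add: u_def)
  have D: "poisson_entropy y l = y * (u - 1 + exp (- u))"
    unfolding u_def using assms by (intro poisson_entropy_exp_form) auto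
  show ?thesis
  proof (cases "u \<le> 2")
    case True
    have "0 \<le> (1 - sqrt y * u / 2)\<^sup>2" by simp
    then have "sqrt y * u \<le> 1 + y * (u\<^sup>2 / 4)"
      using assms by (simp add: power2_diff power_mult_distrib power_divide)
    also have "y * (u\<^sup>2 / 4) \<le> poisson_entropy y l"
      unfolding D using exp_remainder_ge_square[OF u0 True] assms by (intro mult_left_mono) auto
    finally have *: "sqrt y * u \<le> 1 + poisson_entropy y l" by simp
    have "0 \<le> poisson_entropy y l"
      unfolding D using exp_ge_add_one_self[of "- u"] assms by simp
    then show ?thesis using * unfolding u_def by linarith
  next
    case False
    have "sqrt y \<le> y"
      using assms sqrt_le_D real_sqrt_le_iff[of y "y * y"] by (simp add: real_sqrt_mult mult_le_cancel_left1)
    then have "sqrt y * u \<le> y * u"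
      using u0 by (intro mult_right_mono)
    also have "\<dots> \<le> y * (2 * (u - 1 + exp (- u)))"
    proof (rule mult_left_mono)
      show "u \<le> 2 * (u - 1 + exp (- u))"
        using False exp_gt_zero[of "- u"] by argo
    qed (use assms in auto)
    also have "\<dots> = 2 * poisson_entropy y l" by (simp add: D)
    finally show ?thesis unfolding u_def by simp
  qed
qed

lemma poisson_entropy_ge_quadratic:
  assumes "l > 0" "0 \<le> x" "x \<le> l"
  shows "x\<^sup>2 / (8 * l) \<le> poisson_entropy (l + x) l"
proof -
  define y where "y = l + x"
  define u where "u = ln (y / l)"
  have y: "y > 0" "y \<le> 2 * l" using assms by (auto simp: y_def)
  have "y / l \<le> 2" using y assms by (simp add: field_simps)
  then have "u \<le> 2"
    using ln_le_minus_one[of "y / l"] y assms by (simp add: u_def)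
  have "x / y = 1 - inverse (y / l)"
    using y assms by (simp add: y_def field_simps)
  also have "\<dots> \<le> u"
    using ln_le_minus_one[of "inverse (y / l)"] y assms by (simp add: u_def ln_div)
  finally have "x / y \<le> u" .
  have "u \<ge> 0" using assms by (simp add: u_def y_def)
  have "x\<^sup>2 / (8 * l) \<le> x\<^sup>2 / (4 * y)"
    using y assms by (intro divide_left_mono) auto
  also have "\<dots> = y * ((x / y)\<^sup>2 / 4)"
    using y by (simp add: power2_eq_square field_simps)
  also have "\<dots> \<le> y * (u\<^sup>2 / 4)"
    using y assms \<open>x / y \<le> u\<close> by (intro mult_left_mono divide_right_mono power_mono) auto
  also have "\<dots> \<le> y * (u - 1 + exp (- u))"
    using y exp_remainder_ge_square[OF \<open>u \<ge> 0\<close> \<open>u \<le> 2\<close>] by (intro mult_left_mono) auto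
  also have "\<dots> = poisson_entropy y l"
    unfolding u_def using y assms by (intro poisson_entropy_exp_form[symmetric]) auto
  finally show ?thesis unfolding y_def .
qed

section \<open>The right tail\<close>

lemma poisson_right_tail_lower_bound:
  assumes "l > 0" "l \<le> y" "1 \<le> y"
  shows "3 / 4 * exp (- 84) * exp (- (25 * poisson_entropy y l))
         \<le> measure (measure_pmf (poisson_pmf l)) {k. y \<le> real k}"
proof -
  \<comment> \<open>The larger root of \<open>s\<^sup>2 - 2 * s = y\<close>: the window of two standard deviations around the mean
    \<open>s\<^sup>2\<close> begins at \<open>y\<close>.\<close>
  define s where "s = 1 + sqrt (1 + y)"
  define F where "F = (s\<^sup>2 + 2 * s) * ln (s\<^sup>2 / l) - s\<^sup>2 + l"
  define u where "u = ln (y / l)"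
  have "s > 0" using assms by (simp add: s_def add_pos_nonneg)
  have s_eq: "s\<^sup>2 = y + 2 * s"
    using assms by (simp add: s_def power2_eq_square algebra_simps)
  have u0: "u \<ge> 0" using assms by (simp add: u_def)
  have "s \<le> 3 * sqrt y"
  proof -
    have "sqrt (1 + y) \<le> sqrt (4 * y)" using assms by simp
    moreover have "1 \<le> sqrt y" using assms by simp
    ultimately show ?thesis unfolding s_def by (simp add: real_sqrt_mult del: real_sqrt_ge_1_iff)
  qed
  have log: "ln (s\<^sup>2 / l) \<le> u + 2 * s / y"
  proof -
    have "ln (s\<^sup>2 / l) = u + ln (1 + 2 * s / y)"
    proof -
      have "s\<^sup>2 / l = y / l * (1 + 2 * s / y)"
        using assms by (simp add: s_eq field_simps)
      moreover have "1 + 2 * s / y > 0" "y / l > 0"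
        using assms \<open>s > 0\<close> by (auto intro!: add_pos_pos)
      ultimately show ?thesis unfolding u_def by (simp only: ln_mult_pos)
    qed
    also have "ln (1 + 2 * s / y) \<le> 2 * s / y"
      using assms \<open>s > 0\<close> by (intro ln_add_one_self_le_self) auto
    finally show ?thesis by simp
  qed
  have "F \<le> (s\<^sup>2 + 2 * s) * (u + 2 * s / y) - s\<^sup>2 + l"
    unfolding F_def using log \<open>s > 0\<close> by (simp add: mult_left_mono)
  also have "\<dots> = (y + 4 * s) * (u + 2 * s / y) - (y + 2 * s) + l"
    by (simp add: s_eq)
  also have "\<dots> = poisson_entropy y l + 4 * (s * u) + 8 * (s\<^sup>2 / y)"
    unfolding poisson_entropy_def u_def[symmetric] using assms
    by (simp add: field_simps power2_eq_square)
  also have "\<dots> \<le> poisson_entropy y l + 4 * (3 * (sqrt y * u)) + 8 * 9"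
  proof -
    have "s * u \<le> 3 * (sqrt y * u)"
      using mult_right_mono[OF \<open>s \<le> 3 * sqrt y\<close> u0] by simp
    moreover have "s\<^sup>2 \<le> (3 * sqrt y)\<^sup>2"
      using \<open>s > 0\<close> \<open>s \<le> 3 * sqrt y\<close> by (intro power_mono) auto
    then have "s\<^sup>2 / y \<le> 9"
      using assms by (simp add: power_mult_distrib field_simps)
    ultimately show ?thesis by linarith
  qed
  also have "\<dots> \<le> 84 + 25 * poisson_entropy y l"
    using sqrt_log_le_entropy[OF assms] unfolding u_def by linarith
  finally have F: "F \<le> 84 + 25 * poisson_entropy y l" .
  have "3 / 4 * exp (- 84) * exp (- (25 * poisson_entropy y l)) \<le> 3 / 4 * exp (- F)"
    using F by (simp flip: exp_add)
  also have "\<dots> \<le> measure (measure_pmf (poisson_pmf (s\<^sup>2))) {k. \<bar>real k - s\<^sup>2\<bar> \<le> 2 * s} * exp (- F)"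
    using poisson_concentration[OF \<open>s > 0\<close>] by (intro mult_right_mono) auto
  also have "\<dots> \<le> measure (measure_pmf (poisson_pmf l)) {k. y \<le> real k}"
  proof (rule poisson_tilting)
    fix k assume k: "k \<in> {k. \<bar>real k - s\<^sup>2\<bar> \<le> 2 * s}"
    have "1 \<le> s\<^sup>2 / l" using assms \<open>s > 0\<close> by (simp add: s_eq)
    then have "real k * ln (s\<^sup>2 / l) \<le> (s\<^sup>2 + 2 * s) * ln (s\<^sup>2 / l)"
      using k by (intro mult_right_mono) auto
    then show "real k * ln (s\<^sup>2 / l) - s\<^sup>2 + l \<le> F"
      by (simp add: F_def)
  qed (use assms \<open>s > 0\<close> s_eq in auto)
  finally show ?thesis .
qed

section \<open>The left tail\<close>

text \<open>The tilted law has mean \<open>s\<^sup>2\<close>, and \<open>l - s\<^sup>2 = x + 2 * s\<close> exceeds \<open>x\<close> by at most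
  \<open>2 * sqrt l\<close>. Since the threshold is at least \<open>e * l\<close> and \<open>l \<ge> 1\<close>, the standard deviation
  \<open>s\<close> is also at least of order \<open>sqrt l\<close>, so the log-likelihood ratio is bounded by a quadratic
  polynomial in the normalized deviation \<open>x / sqrt l\<close>.\<close>

lemma poisson_left_tail_lower_bound:
  assumes "1 \<le> l" "0 \<le> x" "0 < e" "e * l \<le> l - x"
  shows "3 / 4 * exp (- (8 + 18 / e)) * exp (- ((2 + 6 / e) * (x\<^sup>2 / l)))
         \<le> measure (measure_pmf (poisson_pmf l)) {k. real k \<le> l - x}"
proof -
  \<comment> \<open>The positive root of \<open>s\<^sup>2 + 2 * s = l - x\<close>: the window of two standard deviations around the
    mean \<open>s\<^sup>2\<close> ends at \<open>l - x\<close>.\<close>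
  define s where "s = sqrt (1 + (l - x)) - 1"
  define F where "F = (s\<^sup>2 - 2 * s) * ln (s\<^sup>2 / l) - s\<^sup>2 + l"
  define r where "r = sqrt l"
  define z where "z = x / r"
  have "0 < e * l" using assms by simp
  then have y: "l - x > 0" using assms by linarith
  have "s > 0" using y by (simp add: s_def)
  have s_eq: "s\<^sup>2 = l - x - 2 * s"
    using y by (simp add: s_def power2_eq_square algebra_simps)
  have r: "r \<ge> 1" "r\<^sup>2 = l" "r * r = l" using assms by (auto simp: r_def)
  have z: "z \<ge> 0" "x = z * r" "z\<^sup>2 = x\<^sup>2 / l"
    using r assms by (auto simp: z_def power_divide)
  have "s\<^sup>2 \<le> l" using s_eq assms \<open>s > 0\<close> by linarith
  then have "s \<le> r" unfolding r_def by (rule real_le_rsqrt)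
  have s_lower: "e * r \<le> 3 * s"
  proof -
    have "(e * r) * r \<le> s * (s + 2)"
      using s_eq assms r by (simp add: power2_eq_square algebra_simps)
    also have "\<dots> \<le> s * (3 * r)"
      using \<open>s \<le> r\<close> r \<open>s > 0\<close> by (intro mult_left_mono) auto
    finally have "(e * r) * r \<le> (3 * s) * r" by simp
    then show ?thesis using r by simp
  qed
  have gap: "0 \<le> l - s\<^sup>2" "l - s\<^sup>2 \<le> (z + 2) * r"
    using s_eq \<open>s \<le> r\<close> \<open>s\<^sup>2 \<le> l\<close> z by (auto simp: algebra_simps)
  have "F \<le> (l - s\<^sup>2)\<^sup>2 / l + 2 * ((l - s\<^sup>2) / s)"
  proof -
    have "s\<^sup>2 * ln (s\<^sup>2 / l) \<le> s\<^sup>2 * (s\<^sup>2 / l - 1)"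
      using assms \<open>s > 0\<close> by (intro mult_left_mono ln_le_minus_one) auto
    moreover have "2 * s * ln (l / s\<^sup>2) \<le> 2 * s * (l / s\<^sup>2 - 1)"
      using assms \<open>s > 0\<close> by (intro mult_left_mono ln_le_minus_one) auto
    moreover have "ln (l / s\<^sup>2) = - ln (s\<^sup>2 / l)"
      using assms \<open>s > 0\<close> by (simp add: ln_div)
    ultimately have "F \<le> s\<^sup>2 * (s\<^sup>2 / l - 1) - s\<^sup>2 + l + 2 * s * (l / s\<^sup>2 - 1)"
      by (simp add: F_def algebra_simps)
    also have "\<dots> = (l - s\<^sup>2)\<^sup>2 / l + 2 * ((l - s\<^sup>2) / s)"
      using assms \<open>s > 0\<close> by (simp add: field_simps power2_eq_square)
    finally show ?thesis .
  qed
  also have "\<dots> \<le> (z + 2)\<^sup>2 + 2 * (3 / e * (z + 2))"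
  proof -
    have "(l - s\<^sup>2)\<^sup>2 \<le> ((z + 2) * r)\<^sup>2"
      using gap by (intro power_mono) auto
    then have "(l - s\<^sup>2)\<^sup>2 / l \<le> (z + 2)\<^sup>2"
      using assms unfolding power_mult_distrib r(2) by (simp add: pos_divide_le_eq)
    moreover have "(z + 2) * (e * r) \<le> (z + 2) * (3 * s)"
      using s_lower z by (intro mult_left_mono) auto
    then have "(z + 2) * r \<le> 3 / e * (z + 2) * s"
      using assms by (simp add: field_simps)
    then have "(l - s\<^sup>2) / s \<le> 3 / e * (z + 2)"
      using gap \<open>s > 0\<close> by (simp add: pos_divide_le_eq)
    ultimately show ?thesis by linarith
  qed
  also have "\<dots> \<le> (2 * z\<^sup>2 + 8) + 2 * (3 / e * (z\<^sup>2 + 3))"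
  proof -
    have "(z + 2)\<^sup>2 \<le> 2 * z\<^sup>2 + 8"
      using zero_le_power2[of "z - 2"] by (simp add: power2_eq_square algebra_simps)
    moreover have "z + 2 \<le> z\<^sup>2 + 3"
      using zero_le_power2[of "z - 1 / 2"] by (simp add: power2_eq_square algebra_simps)
    then have "3 / e * (z + 2) \<le> 3 / e * (z\<^sup>2 + 3)"
      using assms by (intro mult_left_mono) auto
    ultimately show ?thesis by linarith
  qed
  also have "\<dots> = (8 + 18 / e) + (2 + 6 / e) * (x\<^sup>2 / l)"
    unfolding z(3)[symmetric] using assms by (simp add: field_simps)
  finally have F: "F \<le> (8 + 18 / e) + (2 + 6 / e) * (x\<^sup>2 / l)" .
  have "3 / 4 * exp (- (8 + 18 / e)) * exp (- ((2 + 6 / e) * (x\<^sup>2 / l))) \<le> 3 / 4 * exp (- F)"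
    using F by (simp flip: exp_add)
  also have "\<dots> \<le> measure (measure_pmf (poisson_pmf (s\<^sup>2))) {k. \<bar>real k - s\<^sup>2\<bar> \<le> 2 * s} * exp (- F)"
    using poisson_concentration[OF \<open>s > 0\<close>] by (intro mult_right_mono) auto
  also have "\<dots> \<le> measure (measure_pmf (poisson_pmf l)) {k. real k \<le> l - x}"
  proof (rule poisson_tilting)
    fix k assume k: "k \<in> {k. \<bar>real k - s\<^sup>2\<bar> \<le> 2 * s}"
    have "ln (s\<^sup>2 / l) \<le> 0" using assms \<open>s > 0\<close> \<open>s\<^sup>2 \<le> l\<close> by simp
    then have "real k * ln (s\<^sup>2 / l) \<le> (s\<^sup>2 - 2 * s) * ln (s\<^sup>2 / l)"
      using k by (intro mult_right_mono_neg) auto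
    then show "real k * ln (s\<^sup>2 / l) - s\<^sup>2 + l \<le> F"
      by (simp add: F_def)
  qed (use assms(1) \<open>s > 0\<close> in \<open>simp_all, use s_eq in auto\<close>)
  finally show ?thesis .
qed

lemma poisson_left_tail_Benn:
  assumes "l > 0" "\<beta> > 1" "0 \<le> x" "x \<le> l / \<beta>"
  defines "e \<equiv> 1 - 1 / \<beta>"
  shows "3 / 4 * exp (- (8 + 18 / e)) * exp (- (8 * (2 + 6 / e) * poisson_entropy (l + x) l))
         \<le> measure (measure_pmf (poisson_pmf l)) {k. real k \<le> l - x}"
proof -
  have e: "e > 0" using assms by (simp add: e_def)
  have "e * l \<le> l - x" using assms by (simp add: e_def algebra_simps)
  moreover have "0 < e * l" using e assms by simp
  ultimately have "x \<le> l" by linarith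
  have quad: "x\<^sup>2 / (8 * l) \<le> poisson_entropy (l + x) l"
    using assms \<open>x \<le> l\<close> by (intro poisson_entropy_ge_quadratic) auto
  show ?thesis
  proof (cases "1 \<le> l")
    case True
    have "(2 + 6 / e) * (x\<^sup>2 / l) = 8 * (2 + 6 / e) * (x\<^sup>2 / (8 * l))"
      using assms by (simp add: divide_simps)
    also have "\<dots> \<le> 8 * (2 + 6 / e) * poisson_entropy (l + x) l"
      using quad e by (intro mult_left_mono) auto
    finally have "3 / 4 * exp (- (8 + 18 / e)) * exp (- (8 * (2 + 6 / e) * poisson_entropy (l + x) l))
        \<le> 3 / 4 * exp (- (8 + 18 / e)) * exp (- ((2 + 6 / e) * (x\<^sup>2 / l)))"
      by (intro mult_left_mono) auto
    also have "\<dots> \<le> measure (measure_pmf (poisson_pmf l)) {k. real k \<le> l - x}"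
      using True assms(3) e \<open>e * l \<le> l - x\<close> by (rule poisson_left_tail_lower_bound)
    finally show ?thesis .
  next
    case False
    have "0 \<le> x\<^sup>2 / (8 * l)" using assms by simp
    then have "0 \<le> 8 * (2 + 6 / e) * poisson_entropy (l + x) l"
      using quad e by (intro mult_nonneg_nonneg) auto
    moreover have "8 + 18 / e \<ge> l"
    proof -
      have "18 / e > 0" using e by simp
      then show ?thesis using False by linarith
    qed
    ultimately have "3 / 4 * exp (- (8 + 18 / e))
        * exp (- (8 * (2 + 6 / e) * poisson_entropy (l + x) l)) \<le> 1 * exp (- l) * 1"
      by (intro mult_mono) auto
    also have "\<dots> = measure (measure_pmf (poisson_pmf l)) {0}"
      using assms by (simp add: measure_pmf_single)
    also have "\<dots> \<le> measure (measure_pmf (poisson_pmf l)) {k. real k \<le> l - x}"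
      using \<open>x \<le> l\<close> by (intro measure_pmf.finite_measure_mono) auto
    finally show ?thesis .
  qed
qed

section \<open>The two-sided tail bound\<close>

lemma poisson_prob_ge_below_one:
  assumes "l > 0" "0 < y" "y < 1"
  shows "measure (measure_pmf (poisson_pmf l)) {k. y \<le> real k} = 1 - exp (- l)"
proof -
  have "{k. y \<le> real k} = UNIV - {0}"
  proof (intro set_eqI)
    fix k show "k \<in> {k. y \<le> real k} \<longleftrightarrow> k \<in> UNIV - {0}"
      using assms by (cases k) auto
  qed
  then show ?thesis
    using measure_pmf.prob_compl[of "{0}" "poisson_pmf l"] assms
    by (simp add: measure_pmf_single)
qed

theorem theorem10:
  "\<exists>(c::real) (C::real) (c\<^sub>\<beta> :: real \<Rightarrow> real) (C\<^sub>\<beta> :: real \<Rightarrow> real).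
     c > 0 \<and> C > 0 \<and> (\<forall>\<beta>>1. c\<^sub>\<beta> \<beta> > 0 \<and> C\<^sub>\<beta> \<beta> > 0) \<and>
     (\<forall>(l::real) > 0.
        (\<forall>x::real. 0 \<le> x \<and> 1 \<le> x + l \<longrightarrow>
           \<P>(Y in measure_pmf (poisson_pmf l). real Y - l \<ge> x)
             \<ge> c * exp (- (C * (x\<^sup>2 / (2 * l) * psi_Benn (x / l))))) \<and>
        (\<forall>x::real. 0 < x + l \<and> x + l < 1 \<longrightarrow>
           \<P>(Y in measure_pmf (poisson_pmf l). real Y - l \<ge> x) = 1 - exp (- l)) \<and>
        (\<forall>\<beta>>1. \<forall>x::real. 0 \<le> x \<and> x \<le> l / \<beta> \<longrightarrow>
           \<P>(Y in measure_pmf (poisson_pmf l). real Y - l \<le> - x)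
             \<ge> c\<^sub>\<beta> \<beta> * exp (- (C\<^sub>\<beta> \<beta> * (x\<^sup>2 / (2 * l) * psi_Benn (x / l))))))"
proof (intro exI conjI allI impI; (elim conjE)?)
  show "3 / 4 * exp (- 84) > (0::real)" "(25::real) > 0" by simp_all
next
  fix \<beta> :: real assume "\<beta> > 1"
  then have "1 - 1 / \<beta> > 0" by simp
  then show "3 / 4 * exp (- (8 + 18 / (1 - 1 / \<beta>))) > 0" "8 * (2 + 6 / (1 - 1 / \<beta>)) > 0"
    by (auto intro: add_pos_pos)
next
  fix l x :: real assume "l > 0" "0 \<le> x" "1 \<le> x + l"
  note poisson_right_tail_lower_bound[of l "l + x", folded Benn_exponent_eq_entropy[OF \<open>l > 0\<close>]]
  moreover have "{Y. real Y - l \<ge> x} = {k. l + x \<le> real k}" by auto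
  ultimately show "\<P>(Y in measure_pmf (poisson_pmf l). real Y - l \<ge> x)
      \<ge> 3 / 4 * exp (- 84) * exp (- (25 * (x\<^sup>2 / (2 * l) * psi_Benn (x / l))))"
    using \<open>l > 0\<close> \<open>0 \<le> x\<close> \<open>1 \<le> x + l\<close> by simp
next
  fix l x :: real assume "l > 0" "0 < x + l" "x + l < 1"
  then show "\<P>(Y in measure_pmf (poisson_pmf l). real Y - l \<ge> x) = 1 - exp (- l)"
    using poisson_prob_ge_below_one[of l "x + l"] by (simp add: algebra_simps)
next
  fix l \<beta> x :: real assume "l > 0" "\<beta> > 1" "0 \<le> x" "x \<le> l / \<beta>"
  note poisson_left_tail_Benn[OF this, folded Benn_exponent_eq_entropy[OF \<open>l > 0\<close>]]
  moreover have "{Y. real Y - l \<le> - x} = {k. real k \<le> l - x}" by auto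
  ultimately show "\<P>(Y in measure_pmf (poisson_pmf l). real Y - l \<le> - x)
      \<ge> 3 / 4 * exp (- (8 + 18 / (1 - 1 / \<beta>)))
        * exp (- (8 * (2 + 6 / (1 - 1 / \<beta>)) * (x\<^sup>2 / (2 * l) * psi_Benn (x / l))))"
    by simp
qed

end
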